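(* Let $\hat\lambda_n$ be the maximum marginal likelihood estimator, $\hat\lambda_n\in\operatorname{argmax}_{\lambda\in\Lambda} m(X_{1:n}|\lambda)$, where $m(X_{1:n}|\lambda)=\int_\Theta p_\theta^{(n)}(X_{1:n})\,\mathrm{d}\Pi(\theta|\lambda)$. Let $\theta_0\in\Theta$ denote the true parameter value and assume: (A1) there exist constants $c_1,c_2>0$ such that, for any $\epsilon>0$, $$P_0^*\Bigl(\sup_{\theta\in U_\epsilon^c}R(p_\theta^{(n)})\ge e^{-c_1n\epsilon^2}\Bigr)\le c_2(n\epsilon^2)^{-(1+t)}\quad\text{for all } n,$$ for some $t>0$, where $P_0^*$ denotes the outer measure of $P_0^\infty$; (A2) for each $\theta_0\in\Theta$ there exists $\lambda_0\in\Lambda$ such that, for any $\eta>0$, $\Pi(B_{\mathrm{KL}}(\theta_0;\eta)|\lambda_0)>0$. Then, for any $\epsilon>0$, $$\Pi(U_\epsilon^c|\hat\lambda_n,X_{1:n})\to0\quad\text{a.s. }[P_0^\infty].$$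
   Context: $\mathcal{X}$ (observations) and $\Theta$ (parameters) are complete separable metric spaces with their Borel $\sigma$-fields; $(X_i)_{i\ge1}$ is a sequence of $\mathcal{X}$-valued random elements whose law is modeled by a family $\{P_\theta^\infty:\theta\in\Theta\}$ of probability measures on $\mathcal{X}^\infty$ (not necessarily i.i.d.). $X_{1:n}=(X_1,\ldots,X_n)$ has law $P_\theta^{(n)}$ with density $p_\theta^{(n)}$ with respect to a common $\sigma$-finite measure $\mu$ (possibly depending on $n$). $\theta_0$ is the true value and $P_0^\infty=P_{\theta_0}^\infty$. The likelihood ratio is $R(p_\theta^{(n)})=p_\theta^{(n)}(X_{1:n})/p_{\theta_0}^{(n)}(X_{1:n})$. $d$ is a semi-metric on $\Theta$ and $U_\epsilon=\{\theta\in\Theta:d(\theta,\theta_0)<\epsilon\}$. $\mathrm{KL}_\infty(\theta_0;\theta)=-\lim_{n\to\infty}n^{-1}\log R(p_\theta^{(n)})$ (the $P_0^\infty$-a.s. limit, assumed to be a nonrandom number; in the i.i.d. case it is the Kullback–Leibler divergence of $p_\theta$ from $p_{\theta_0}$), and $B_{\mathrm{KL}}(\theta_0;\eta)=\{\theta\in\Theta:\mathrm{KL}_\infty(\theta_0;\theta)<\eta\}$. $\{\Pi(\cdot|\lambda):\lambda\in\Lambda\}$ is a family of prior probability measures on $\Theta$. The estimator may take values in the closure $\bar\Lambda$; for $\lambda_0$ in the boundary of $\Lambda$, $\Pi(\cdot|\lambda_0)$ is the weak limit of $\Pi(\cdot|\lambda)$ as $\lambda\to\lambda_0$, when it exists.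 In all cases $\hat m(X_{1:n}):=m(X_{1:n}|\hat\lambda_n)=\sup_{\lambda\in\Lambda}m(X_{1:n}|\lambda)$, and this supremum is assumed finite for all large $n$, $P_\theta^\infty$-a.s., for all $\theta$. The empirical Bayes posterior is $$\Pi(B|\hat\lambda_n,X_{1:n})=\frac{\int_B p_\theta^{(n)}(X_{1:n})\,\mathrm{d}\Pi(\theta|\hat\lambda_n)}{\int_\Theta p_\theta^{(n)}(X_{1:n})\,\mathrm{d}\Pi(\theta|\hat\lambda_n)},$$ assumed well defined, i.e. a probability measure for all large $n$, $P_\theta^\infty$-a.s., for all $\theta$. The usual measurability (e.g. joint measurability of $(x,\theta)\mapsto p_\theta^{(n)}(x)$, measurability of the sets to which priors are applied) is assumed. *)

theory Defs
  imports "HOL-Probability.Probability"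
begin

text \<open>
  Observations are coordinates, numbered from 0: the random element \<open>X\<^sub>i\<close> (\<open>i \<ge> 1\<close>) at the
  sample path \<open>\<omega>\<close> is \<open>\<omega> (i - 1)\<close>, so \<open>X\<^sub>1, \<dots>, X\<^sub>n\<close> is the restriction of \<open>\<omega>\<close> to \<open>{..<n}\<close>.
\<close>

definition path_space :: "(nat \<Rightarrow> 'x::polish_space) measure" where
  "path_space = Pi\<^sub>M UNIV (\<lambda>_. borel)"

definition obs_space :: "nat \<Rightarrow> (nat \<Rightarrow> 'x::polish_space) measure" where
  "obs_space n = Pi\<^sub>M {..<n} (\<lambda>_. borel)"

definition obs :: "nat \<Rightarrow> (nat \<Rightarrow> 'x) \<Rightarrow> (nat \<Rightarrow> 'x)" where
  "obs n \<omega> = restrict \<omega> {..<n}"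

text \<open>
  A semi-metric need not separate points. The triangle inequality, which some authors include
  and others do not, is not required here.
\<close>

definition semimetric :: "('a \<Rightarrow> 'a \<Rightarrow> real) \<Rightarrow> bool" where
  "semimetric d \<longleftrightarrow> (\<forall>x y. 0 \<le> d x y \<and> d x y = d y x) \<and> (\<forall>x. d x x = 0)"

definition nbhd :: "('a \<Rightarrow> 'a \<Rightarrow> real) \<Rightarrow> 'a \<Rightarrow> real \<Rightarrow> 'a set" where
  "nbhd d \<theta>0 \<epsilon> = {\<theta>. d \<theta> \<theta>0 < \<epsilon>}"

text \<open>
  The argument \<open>p n \<theta>\<close> is the density of \<open>X\<^sub>1, \<dots>, X\<^sub>n\<close> under \<open>\<theta>\<close>. Where the density at \<open>\<theta>0\<close>
  vanishes, which happens with probability 0 under \<open>\<theta>0\<close>, the ratio is 0 by convention.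
\<close>

definition lik_ratio ::
  "(nat \<Rightarrow> 'p \<Rightarrow> (nat \<Rightarrow> 'x) \<Rightarrow> real) \<Rightarrow> 'p \<Rightarrow> nat \<Rightarrow> 'p \<Rightarrow> (nat \<Rightarrow> 'x) \<Rightarrow> real" where
  "lik_ratio p \<theta>0 n \<theta> \<omega> = p n \<theta> (obs n \<omega>) / p n \<theta>0 (obs n \<omega>)"

text \<open>The logarithm with \<open>log 0 = -\<infinity>\<close>; \<^const>\<open>ln\<close> would give \<open>0\<close> there.\<close>

definition ln_ext :: "real \<Rightarrow> ereal" where
  "ln_ext r = (if r \<le> 0 then -\<infinity> else ereal (ln r))"

definition has_KL_inf ::
  "('p \<Rightarrow> (nat \<Rightarrow> 'x) measure) \<Rightarrow> (nat \<Rightarrow> 'p \<Rightarrow> (nat \<Rightarrow> 'x) \<Rightarrow> real) \<Rightarrow> 'p \<Rightarrow> 'p \<Rightarrow> ereal \<Rightarrow> bool"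
where
  "has_KL_inf P p \<theta>0 \<theta> k \<longleftrightarrow>
     (AE \<omega> in P \<theta>0. (\<lambda>n. ereal (1 / real n) * ln_ext (lik_ratio p \<theta>0 n \<theta> \<omega>)) \<longlonglongrightarrow> - k)"

definition KL_inf ::
  "('p \<Rightarrow> (nat \<Rightarrow> 'x) measure) \<Rightarrow> (nat \<Rightarrow> 'p \<Rightarrow> (nat \<Rightarrow> 'x) \<Rightarrow> real) \<Rightarrow> 'p \<Rightarrow> 'p \<Rightarrow> ereal"
where
  "KL_inf P p \<theta>0 \<theta> = (THE k. has_KL_inf P p \<theta>0 \<theta> k)"

definition KL_ball ::
  "('p \<Rightarrow> (nat \<Rightarrow> 'x) measure) \<Rightarrow> (nat \<Rightarrow> 'p \<Rightarrow> (nat \<Rightarrow> 'x) \<Rightarrow> real) \<Rightarrow> 'p \<Rightarrow> real \<Rightarrow> 'p set"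
where
  "KL_ball P p \<theta>0 \<eta> = {\<theta>. KL_inf P p \<theta>0 \<theta> < ereal \<eta>}"

definition weak_limit ::
  "('l \<Rightarrow> 'p::polish_space measure) \<Rightarrow> 'p measure \<Rightarrow> 'l filter \<Rightarrow> bool"
where
  "weak_limit Q Q0 F \<longleftrightarrow>
     (\<forall>f :: 'p \<Rightarrow> real. continuous_on UNIV f \<longrightarrow> bounded (range f) \<longrightarrow>
        ((\<lambda>l. \<integral>\<theta>. f \<theta> \<partial>Q l) \<longlongrightarrow> (\<integral>\<theta>. f \<theta> \<partial>Q0)) F)"

text \<open>
  The hyperparameters at which the prior is defined: all of \<open>L\<close>, and those limit points of \<open>L\<close>
  outside \<open>L\<close> at which the weak limit of the priors exists. The family \<open>prior\<close> is total, so at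
  such a limit point its value has to be that weak limit.
\<close>

definition ext_hyper :: "'l::topological_space set \<Rightarrow> ('l \<Rightarrow> 'p::polish_space measure) \<Rightarrow> 'l set"
where
  "ext_hyper L prior =
     L \<union> {l0 \<in> closure L - L.
            prior l0 \<in> space (prob_algebra borel) \<and> weak_limit prior (prior l0) (at l0 within L)}"

definition marg_lik ::
  "(nat \<Rightarrow> 'p \<Rightarrow> (nat \<Rightarrow> 'x) \<Rightarrow> real) \<Rightarrow> ('l \<Rightarrow> 'p::polish_space measure) \<Rightarrow> nat \<Rightarrow> (nat \<Rightarrow> 'x)
     \<Rightarrow> 'l \<Rightarrow> ennreal"
where
  "marg_lik p prior n x l = (\<integral>\<^sup>+\<theta>. ennreal (p n \<theta> x) \<partial>prior l)"

definition is_MMLE ::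
  "(nat \<Rightarrow> 'p \<Rightarrow> (nat \<Rightarrow> 'x) \<Rightarrow> real) \<Rightarrow> 'l::topological_space set \<Rightarrow> ('l \<Rightarrow> 'p::polish_space measure)
     \<Rightarrow> nat \<Rightarrow> (nat \<Rightarrow> 'x) \<Rightarrow> 'l \<Rightarrow> bool"
where
  "is_MMLE p L prior n x l \<longleftrightarrow>
     l \<in> ext_hyper L prior \<and> marg_lik p prior n x l = (SUP l'\<in>L. marg_lik p prior n x l')"

text \<open>
  When the denominator is 0 or infinite, the quotient below is 0 for every \<open>B\<close>, so that the
  posterior is then not a probability measure.
\<close>

definition posterior ::
  "(nat \<Rightarrow> 'p \<Rightarrow> (nat \<Rightarrow> 'x) \<Rightarrow> real) \<Rightarrow> ('l \<Rightarrow> 'p::polish_space measure) \<Rightarrow> nat \<Rightarrow> (nat \<Rightarrow> 'x)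
     \<Rightarrow> 'l \<Rightarrow> 'p measure"
where
  "posterior p prior n x l =
     measure_of UNIV (sets borel)
       (\<lambda>B. (\<integral>\<^sup>+\<theta>\<in>B. ennreal (p n \<theta> x) \<partial>prior l) / (\<integral>\<^sup>+\<theta>. ennreal (p n \<theta> x) \<partial>prior l))"

end

theory Submission
  imports Defs "HOL-Real_Asymp.Real_Asymp"
begin

text \<open>
  By (A1) and Borel-Cantelli, the likelihood ratio on the complement of the neighbourhood is
  eventually at most \<open>exp (- c1 n \<epsilon>\<^sup>2)\<close>, which bounds the numerator of the posterior whatever the
  prior selected by the estimator. The denominator is the maximal marginal likelihood, hence at
  least that of the fixed prior from (A2); restricting the integral to a Kullback-Leibler ball of
  radius \<open>\<eta> = c1 \<epsilon>\<^sup>2 / 2\<close> bounds it below by a constant times \<open>exp (- n \<eta>)\<close>, relative to the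
  likelihood at \<open>\<theta>0\<close>. The quotient decays like \<open>exp (- n \<eta>)\<close>.
\<close>

text \<open>Two almost sure limits of one sequence agree almost surely. Their equality does not
  involve the path, so under a probability measure it holds outright, and the description in
  \<open>KL_inf\<close> denotes that limit.\<close>

lemma KL_inf_eq:
  assumes "prob_space (P \<theta>0)" and "has_KL_inf P p \<theta>0 \<theta> k"
  shows "KL_inf P p \<theta>0 \<theta> = k"
  unfolding KL_inf_def
proof (rule the_equality)
  interpret prob_space "P \<theta>0" by fact
  fix k' assume "has_KL_inf P p \<theta>0 \<theta> k'"
  then have "AE \<omega> in P \<theta>0. k' = k"
    using assms(2) unfolding has_KL_inf_def
    by eventually_elim (metis LIMSEQ_unique ereal_uminus_eq_iff)
  then show "k' = k" by simp
qed fact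

text \<open>Turns membership in a Kullback-Leibler ball into an explicit exponential lower bound:
  the normalised logarithms converge to a value above \<open>- \<eta>\<close>, so they eventually
  exceed it.\<close>

lemma eventually_exp_le_of_ln_ext_limit:
  assumes lim: "(\<lambda>n. ereal (1 / real n) * ln_ext (r n)) \<longlonglongrightarrow> - k" and k: "k < ereal \<eta>"
  shows "\<forall>\<^sub>F n in sequentially. exp (- (real n * \<eta>)) \<le> r n"
proof -
  have "ereal (- \<eta>) < - k"
    using k by (metis ereal_minus_less_minus uminus_ereal.simps(1))
  then have "\<forall>\<^sub>F n in sequentially. ereal (- \<eta>) < ereal (1 / real n) * ln_ext (r n)"
    using lim by (rule order_tendstoD(1)[rotated])
  then show ?thesis
    using eventually_gt_at_top[of 0]
  proof eventually_elim
    case (elim n)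
    \<comment> \<open>For \<open>n > 0\<close> a nonpositive \<open>r n\<close> would make the
      product \<open>-\<infinity>\<close>; at \<open>n = 0\<close> the factor
      \<open>1 / real n\<close> is 0 and the product would be 0.\<close>
    then have r: "0 < r n" by (auto simp: ln_ext_def split: if_splits)
    with elim have "- \<eta> < 1 / real n * ln (r n)" by (simp add: ln_ext_def)
    then have "- (real n * \<eta>) \<le> ln (r n)"
      using elim(2) by (simp add: field_simps)
    with r show ?case by (simp add: ln_ge_iff)
  qed
qed

text \<open>Borel-Cantelli for sets that may fail to be measurable, such as events defined by an
  uncountable supremum: each set is enlarged to a measurable hull with the same outer
  measure.\<close>

lemma AE_eventually_notin_of_summable_outer_measure:
  assumes A: "\<And>n. A n \<subseteq> space M"
    and b: "\<And>n. outer_measure_of M (A n) \<le> ennreal (b n)" "\<And>n. 0 \<le> b n" "summable b"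
  shows "AE \<omega> in M. \<forall>\<^sub>F n in sequentially. \<omega> \<notin> A n"
proof -
  have "\<exists>E. E \<in> sets M \<and> A n \<subseteq> E \<and> emeasure M E = outer_measure_of M (A n)" for n
    using outer_measure_of_attain[OF A[of n]] by metis
  then obtain E where E: "\<And>n. E n \<in> sets M" "\<And>n. A n \<subseteq> E n"
      "\<And>n. emeasure M (E n) = outer_measure_of M (A n)"
    by metis
  have fin: "emeasure M (E n) < \<infinity>" for n
    using b(1)[of n] E(3)[of n] by (simp add: order_le_less_trans)
  have "measure M (E n) \<le> b n" for n
    using b(1)[of n] b(2)[of n] E(3)[of n] by (simp add: measure_def enn2real_leI)
  then have "summable (\<lambda>n. measure M (E n))"
    by (intro summable_comparison_test'[OF b(3), of 0]) simp
  then have "AE \<omega> in M. \<forall>\<^sub>F n in sequentially. \<omega> \<in> space M - E n"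
    by (intro borel_cantelli_AE1 E fin)
  then show ?thesis
  proof eventually_elim
    case (elim \<omega>)
    then show ?case
      by eventually_elim (use E(2) in blast)
  qed
qed

text \<open>
  Fubini turns the pointwise bounds into bounds for almost every \<open>\<theta>\<close> with \<open>\<omega>\<close> fixed, and Fatou's
  lemma shows that the set of those \<open>\<theta>\<close> where the bound holds at stage \<open>n\<close> eventually has mass
  above \<open>a\<close>.
\<close>
lemma AE_eventually_nn_integral_ge:
  fixes f :: "nat \<Rightarrow> 'a \<Rightarrow> 'b \<Rightarrow> ennreal"
  assumes M: "sigma_finite_measure M" and Q: "sigma_finite_measure Q"
    and [measurable]: "\<And>n. (\<lambda>(x, y). f n x y) \<in> borel_measurable (M \<Otimes>\<^sub>M Q)"
    and B [measurable]: "B \<in> sets Q" and a: "a < emeasure Q B"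
    and f: "\<And>y. y \<in> B \<Longrightarrow> AE x in M. \<forall>\<^sub>F n in sequentially. c n \<le> f n x y"
  shows "AE x in M. \<forall>\<^sub>F n in sequentially. c n * a \<le> (\<integral>\<^sup>+y. f n x y \<partial>Q)"
proof -
  interpret M: sigma_finite_measure M by fact
  interpret Q: sigma_finite_measure Q by fact
  interpret pair_sigma_finite M Q ..
  have "AE y in Q. AE x in M. y \<in> B \<longrightarrow> (\<forall>\<^sub>F n in sequentially. c n \<le> f n x y)"
  proof (rule AE_I2)
    fix y
    show "AE x in M. y \<in> B \<longrightarrow> (\<forall>\<^sub>F n in sequentially. c n \<le> f n x y)"
      by (cases "y \<in> B") (simp_all add: f)
  qed
  \<comment> \<open>Exchanging the two quantifiers needs a jointly measurable event; unfolding the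
    eventual bound into quantifiers over naturals makes it one.\<close>
  then have "AE x in M. AE y in Q. y \<in> B \<longrightarrow> (\<forall>\<^sub>F n in sequentially. c n \<le> f n x y)"
    by (subst AE_commute) (simp_all add: eventually_sequentially)
  then show ?thesis
    using AE_space
  proof eventually_elim
    case (elim x)
    then have x [measurable]: "x \<in> space M" by simp
    have fx [measurable]: "f n x \<in> borel_measurable Q" for n
      using measurable_compose[OF measurable_Pair1'[OF x] assms(3)[of n]] by simp
    define S where "S n = {y \<in> space Q. y \<in> B \<and> c n \<le> f n x y}" for n
    have S [measurable]: "S n \<in> sets Q" for n
      unfolding S_def by measurable
    have "emeasure Q B = (\<integral>\<^sup>+y. indicator B y \<partial>Q)"
      by simp
    also have "\<dots> \<le> (\<integral>\<^sup>+y. liminf (\<lambda>n. indicator (S n) y) \<partial>Q)"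
    proof (rule nn_integral_mono_AE)
      show "AE y in Q. indicator B y \<le> liminf (\<lambda>n. indicator (S n) y :: ennreal)"
        using elim(1) AE_space
      proof eventually_elim
        case (elim y)
        show ?case
        proof (cases "y \<in> B")
          case True
          with elim have "\<forall>\<^sub>F n in sequentially. (1::ennreal) \<le> indicator (S n) y"
            by (auto simp: S_def elim: eventually_mono)
          then show ?thesis using True by (auto intro: Liminf_bounded)
        qed simp
      qed
    qed
    also have "\<dots> \<le> liminf (\<lambda>n. \<integral>\<^sup>+y. indicator (S n) y \<partial>Q)"
      by (rule nn_integral_liminf) simp
    also have "\<dots> = liminf (\<lambda>n. emeasure Q (S n))"
      by simp
    finally have "a < liminf (\<lambda>n. emeasure Q (S n))"
      using a by simp
    then have "\<forall>\<^sub>F n in sequentially. a < emeasure Q (S n)"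
      by (rule less_LiminfD)
    then show ?case
    proof eventually_elim
      case (elim n)
      \<comment> \<open>As in Markov's inequality, the integral is at least its part over
        \<open>S n\<close>, where the integrand is at least \<open>c n\<close>.\<close>
      have "c n * a \<le> c n * emeasure Q (S n)"
        using elim by (intro mult_left_mono) auto
      also have "\<dots> = (\<integral>\<^sup>+y. c n * indicator (S n) y \<partial>Q)"
        by (simp add: nn_integral_cmult_indicator)
      also have "\<dots> \<le> (\<integral>\<^sup>+y. f n x y \<partial>Q)"
        by (intro nn_integral_mono) (auto simp: S_def split: split_indicator)
      finally show ?case .
    qed
  qed
qed

lemma AE_density_pos:
  fixes f :: "'b \<Rightarrow> real"
  assumes X: "X \<in> measurable M N" and \<mu>: "sets \<mu> = sets N"
    and distr: "distr M N X = density \<mu> (\<lambda>x. ennreal (f x))"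
    and f [measurable]: "f \<in> borel_measurable N"
  shows "AE \<omega> in M. 0 < f (X \<omega>)"
proof -
  have [measurable]: "f \<in> borel_measurable \<mu>"
    using f measurable_cong_sets[OF \<mu> refl] by blast
  \<comment> \<open>Under \<open>density\<close>, an almost sure claim has to be checked only where
    the density is positive, and there it is the claim itself.\<close>
  have "AE x in distr M N X. 0 < f x"
    unfolding distr by (subst AE_density) simp_all
  then show ?thesis
    by (subst (asm) AE_distr_iff[OF X]) simp_all
qed

lemma divide_mono_ennreal:
  fixes a b c d :: ennreal
  assumes "a \<le> b" and "d \<le> c"
  shows "a / c \<le> b / d"
proof -
  have "inverse c \<le> inverse d"
    using assms(2)
    by (simp add: less_eq_ennreal.rep_eq inverse_ennreal.rep_eq ereal_inverse_antimono)
  with assms(1) show ?thesis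
    unfolding divide_ennreal_def by (intro mult_mono) auto
qed

text \<open>Only an inequality, since \<^const>\<open>measure_of\<close> is 0 when its argument is not a measure.\<close>
lemma emeasure_posterior_le:
  "emeasure (posterior p prior n x l) B
    \<le> (\<integral>\<^sup>+\<theta>\<in>B. ennreal (p n \<theta> x) \<partial>prior l) / marg_lik p prior n x l"
  unfolding posterior_def marg_lik_def by (simp add: emeasure_measure_of_conv)

lemma ext_hyper_prob_algebra:
  assumes "\<And>l. l \<in> L \<Longrightarrow> prior l \<in> space (prob_algebra borel)" and "l \<in> ext_hyper L prior"
  shows "prior l \<in> space (prob_algebra borel)"
  using assms by (auto simp: ext_hyper_def)

lemma measurable_obs: "obs n \<in> measurable path_space (obs_space n)"
  unfolding obs_def[abs_def] path_space_def obs_space_def by (rule measurable_restrict_subset) simp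

theorem proposition2p2:
  fixes P :: "'p::polish_space \<Rightarrow> (nat \<Rightarrow> 'x::polish_space) measure"
    and \<mu> :: "nat \<Rightarrow> (nat \<Rightarrow> 'x) measure"
    and p :: "nat \<Rightarrow> 'p \<Rightarrow> (nat \<Rightarrow> 'x) \<Rightarrow> real"
    and d :: "'p \<Rightarrow> 'p \<Rightarrow> real"
    and \<theta>0 :: 'p
    and L :: "'l::topological_space set"
    and prior :: "'l \<Rightarrow> 'p measure"
    and lhat :: "nat \<Rightarrow> (nat \<Rightarrow> 'x) \<Rightarrow> 'l"
  assumes model: "\<And>\<theta>. P \<theta> \<in> space (prob_algebra path_space)"
    and dominating: "\<And>n. n \<ge> 1 \<Longrightarrow> sigma_finite_measure (\<mu> n) \<and> sets (\<mu> n) = sets (obs_space n)"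
    and density_nonneg: "\<And>n \<theta> x. n \<ge> 1 \<Longrightarrow> x \<in> space (obs_space n) \<Longrightarrow> 0 \<le> p n \<theta> x"
    and density_measurable:
      "\<And>n. n \<ge> 1 \<Longrightarrow> (\<lambda>(x, \<theta>). p n \<theta> x) \<in> borel_measurable (obs_space n \<Otimes>\<^sub>M borel)"
    and density: "\<And>n \<theta>. n \<ge> 1 \<Longrightarrow>
      distr (P \<theta>) (obs_space n) (obs n) = density (\<mu> n) (\<lambda>x. ennreal (p n \<theta> x))"
    and semimetric: "semimetric d"
    and nbhd_measurable: "\<And>\<epsilon>. \<epsilon> > 0 \<Longrightarrow> nbhd d \<theta>0 \<epsilon> \<in> sets borel"
    and prior: "\<And>l. l \<in> L \<Longrightarrow> prior l \<in> space (prob_algebra borel)"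
    and KL_exists: "\<And>\<theta>1 \<theta>. \<exists>k. has_KL_inf P p \<theta>1 \<theta> k"
    and KL_ball_measurable: "\<And>\<theta>1 \<eta>. \<eta> > 0 \<Longrightarrow> KL_ball P p \<theta>1 \<eta> \<in> sets borel"
    and mmle: "\<And>\<theta>. AE \<omega> in P \<theta>. eventually (\<lambda>n.
      is_MMLE p L prior n (obs n \<omega>) (lhat n (obs n \<omega>))) sequentially"
    and sup_finite: "\<And>\<theta>. AE \<omega> in P \<theta>. eventually (\<lambda>n.
      (SUP l\<in>L. marg_lik p prior n (obs n \<omega>) l) < \<infinity>) sequentially"
    and posterior_well_defined: "\<And>\<theta>. AE \<omega> in P \<theta>. eventually (\<lambda>n.
      prob_space (posterior p prior n (obs n \<omega>) (lhat n (obs n \<omega>)))) sequentially"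
    and A1: "\<exists>c1>0. \<exists>c2>0. \<forall>\<epsilon>>0. \<exists>t>0. \<forall>n\<ge>1.
      outer_measure_of (P \<theta>0)
        {\<omega> \<in> space (P \<theta>0).
           (SUP \<theta> \<in> - nbhd d \<theta>0 \<epsilon>. ennreal (lik_ratio p \<theta>0 n \<theta> \<omega>))
             \<ge> ennreal (exp (- (c1 * real n * \<epsilon>\<^sup>2)))}
      \<le> ennreal (c2 * (real n * \<epsilon>\<^sup>2) powr (- (1 + t)))"
    and A2: "\<forall>\<theta>1. \<exists>l0\<in>L. \<forall>\<eta>>0. measure (prior l0) (KL_ball P p \<theta>1 \<eta>) > 0"
  shows "\<forall>\<epsilon>>0. AE \<omega> in P \<theta>0.
    (\<lambda>n. measure (posterior p prior n (obs n \<omega>) (lhat n (obs n \<omega>))) (- nbhd d \<theta>0 \<epsilon>)) \<longlonglongrightarrow> 0"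
proof (intro allI impI)
  fix \<epsilon> :: real assume \<epsilon>: "0 < \<epsilon>"
  \<comment> \<open>The exponent \<open>t\<close> may depend on \<open>\<epsilon>\<close>, which is
    fixed from here on.\<close>
  obtain c1 c2 t where c1: "0 < c1" and c2: "0 < c2" and t: "0 < t"
    and tail: "\<And>n. n \<ge> 1 \<Longrightarrow> outer_measure_of (P \<theta>0)
        {\<omega> \<in> space (P \<theta>0).
           (SUP \<theta> \<in> - nbhd d \<theta>0 \<epsilon>. ennreal (lik_ratio p \<theta>0 n \<theta> \<omega>))
             \<ge> ennreal (exp (- (c1 * real n * \<epsilon>\<^sup>2)))}
      \<le> ennreal (c2 * (real n * \<epsilon>\<^sup>2) powr (- (1 + t)))"
    using A1 \<epsilon> by meson
  obtain l0 where l0: "l0 \<in> L" and mass: "\<And>\<eta>. \<eta> > 0 \<Longrightarrow> measure (prior l0) (KL_ball P p \<theta>0 \<eta>) > 0"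
    using A2 by meson
  define \<eta> where "\<eta> = c1 * \<epsilon>\<^sup>2 / 2"
  have \<eta>: "0 < \<eta>" using c1 \<epsilon> by (simp add: \<eta>_def)
  define B where "B = KL_ball P p \<theta>0 \<eta>"
  \<comment> \<open>Half the mass of the ball, because Fatou's lemma yields an eventual bound only
    for values strictly below the full mass.\<close>
  define q where "q = measure (prior l0) B / 2"
  have q: "0 < q" using mass[OF \<eta>] by (simp add: q_def B_def)
  have P0: "prob_space (P \<theta>0)" and sets_P0: "sets (P \<theta>0) = sets path_space"
    using model[of \<theta>0] by (auto simp: space_prob_algebra)
  have Q0: "prob_space (prior l0)" and sets_Q0: "sets (prior l0) = sets borel"
    using prior[OF l0] by (auto simp: space_prob_algebra)
  interpret P0: prob_space "P \<theta>0" by (rule P0)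
  interpret Q0: prob_space "prior l0" by (rule Q0)
  have obs_meas [measurable]: "obs n \<in> measurable (P \<theta>0) (obs_space n)" for n
    using measurable_obs sets_P0 measurable_cong_sets by blast
  have obs_in: "obs n \<omega> \<in> space (obs_space n)" for n and \<omega> :: "nat \<Rightarrow> 'x"
    by (auto simp: obs_def obs_space_def space_PiM)
  have p_meas: "(\<lambda>x. p n \<theta> x) \<in> borel_measurable (obs_space n)" if "n \<ge> 1" for n \<theta>
    using measurable_compose[OF measurable_Pair2'[of \<theta> borel] density_measurable[OF that]] by simp
  \<comment> \<open>Measurability on pairs of a path and a parameter, as Fubini requires.\<close>
  have joint: "(\<lambda>(\<omega>, \<theta>). p n \<theta> (obs n \<omega>)) \<in> borel_measurable (P \<theta>0 \<Otimes>\<^sub>M prior l0)" if "n \<ge> 1" for n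
  proof -
    have [measurable]: "snd \<in> measurable (P \<theta>0 \<Otimes>\<^sub>M prior l0) borel"
      using measurable_snd[of "P \<theta>0" "prior l0"] measurable_cong_sets[OF refl sets_Q0] by blast
    have "(\<lambda>z. (obs n (fst z), snd z)) \<in> measurable (P \<theta>0 \<Otimes>\<^sub>M prior l0) (obs_space n \<Otimes>\<^sub>M borel)"
      by measurable
    from measurable_compose[OF this density_measurable[OF that]] show ?thesis
      by (simp add: case_prod_beta)
  qed

  \<comment> \<open>Positivity at \<open>\<theta>0\<close> allows likelihood ratios to be multiplied
    back into likelihoods, past the convention for division by 0. Indices are shifted to
    \<open>Suc n\<close> because the model describes only sample sizes
    \<open>n \<ge> 1\<close>.\<close>
  have pos: "AE \<omega> in P \<theta>0. \<forall>n. 0 < p (Suc n) \<theta>0 (obs (Suc n) \<omega>)"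
    unfolding AE_all_countable
  proof
    fix n
    show "AE \<omega> in P \<theta>0. 0 < p (Suc n) \<theta>0 (obs (Suc n) \<omega>)"
      using density[of "Suc n" \<theta>0] dominating[of "Suc n"] p_meas[of "Suc n" \<theta>0]
      by (intro AE_density_pos[OF obs_meas]) auto
  qed

  have lower: "AE \<omega> in P \<theta>0. \<forall>\<^sub>F n in sequentially.
      ennreal (exp (- (real (Suc n) * \<eta>))) * ennreal q
        \<le> (\<integral>\<^sup>+\<theta>. ennreal (lik_ratio p \<theta>0 (Suc n) \<theta> \<omega>) \<partial>prior l0)"
  proof (rule AE_eventually_nn_integral_ge)
    show "sigma_finite_measure (P \<theta>0)" "sigma_finite_measure (prior l0)"
      by unfold_locales
    show "B \<in> sets (prior l0)"
      using KL_ball_measurable[OF \<eta>] by (simp add: sets_Q0 B_def)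
    show "ennreal q < emeasure (prior l0) B"
      using q by (simp add: Q0.emeasure_eq_measure q_def ennreal_less_iff)
    fix n
    have [measurable]: "(\<lambda>\<omega>. p (Suc n) \<theta>0 (obs (Suc n) \<omega>)) \<in> borel_measurable (P \<theta>0)"
      by (rule measurable_compose[OF obs_meas p_meas]) simp
    note [measurable] = joint[of "Suc n"]
    show "(\<lambda>(\<omega>, \<theta>). ennreal (lik_ratio p \<theta>0 (Suc n) \<theta> \<omega>)) \<in> borel_measurable (P \<theta>0 \<Otimes>\<^sub>M prior l0)"
      unfolding lik_ratio_def by measurable
  next
    fix \<theta> assume "\<theta> \<in> B"
    \<comment> \<open>The ball is defined through the number \<open>KL_inf\<close>; existence of the
      limit identifies that number with an actual almost sure limit.\<close>
    obtain k where k: "has_KL_inf P p \<theta>0 \<theta> k" using KL_exists by blast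
    with \<open>\<theta> \<in> B\<close> have "k < ereal \<eta>"
      by (simp add: B_def KL_ball_def KL_inf_eq[OF P0 k])
    from k have "AE \<omega> in P \<theta>0. \<forall>\<^sub>F n in sequentially. exp (- (real n * \<eta>)) \<le> lik_ratio p \<theta>0 n \<theta> \<omega>"
      unfolding has_KL_inf_def
      by eventually_elim (rule eventually_exp_le_of_ln_ext_limit[OF _ \<open>k < ereal \<eta>\<close>])
    then show "AE \<omega> in P \<theta>0. \<forall>\<^sub>F n in sequentially.
        ennreal (exp (- (real (Suc n) * \<eta>))) \<le> ennreal (lik_ratio p \<theta>0 (Suc n) \<theta> \<omega>)"
    proof eventually_elim
      case (elim \<omega>)
      from eventually_compose_filterlim[OF this filterlim_Suc] show ?case
        by eventually_elim (rule ennreal_leI)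
    qed
  qed

  define A where "A n = {\<omega> \<in> space (P \<theta>0).
           (SUP \<theta> \<in> - nbhd d \<theta>0 \<epsilon>. ennreal (lik_ratio p \<theta>0 n \<theta> \<omega>))
             \<ge> ennreal (exp (- (c1 * real n * \<epsilon>\<^sup>2)))}" for n
  have upper: "AE \<omega> in P \<theta>0. \<forall>\<^sub>F n in sequentially. \<omega> \<notin> A (Suc n)"
  proof (rule AE_eventually_notin_of_summable_outer_measure)
    show "A (Suc n) \<subseteq> space (P \<theta>0)" for n by (auto simp: A_def)
    show "outer_measure_of (P \<theta>0) (A (Suc n))
        \<le> ennreal (c2 * (real (Suc n) * \<epsilon>\<^sup>2) powr (- (1 + t)))" for n
      unfolding A_def by (rule tail) simp
    show "0 \<le> c2 * (real (Suc n) * \<epsilon>\<^sup>2) powr (- (1 + t))" for n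
      using c2 by simp
    \<comment> \<open>The tail bounds form a p-series with exponent \<open>1 + t > 1\<close>, up to
      a constant factor involving \<open>\<epsilon>\<close>.\<close>
    have "summable (\<lambda>n. real n powr (- (1 + t)))"
      using t by (simp add: summable_real_powr_iff)
    then have "summable (\<lambda>n. c2 * ((\<epsilon>\<^sup>2) powr (- (1 + t)) * real (Suc n) powr (- (1 + t))))"
      by (intro summable_mult) (subst summable_Suc_iff)
    then show "summable (\<lambda>n. c2 * (real (Suc n) * \<epsilon>\<^sup>2) powr (- (1 + t)))"
      by (simp only: powr_mult mult.commute[of "(\<epsilon>\<^sup>2) powr _"])
  qed

  show "AE \<omega> in P \<theta>0.
    (\<lambda>n. measure (posterior p prior n (obs n \<omega>) (lhat n (obs n \<omega>))) (- nbhd d \<theta>0 \<epsilon>)) \<longlonglongrightarrow> 0"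
    using pos lower upper mmle[of \<theta>0] AE_space
  proof eventually_elim
    case (elim \<omega>)
    \<comment> \<open>The path is now fixed outside a null set, and the remaining argument is
      deterministic.\<close>
    let ?post = "\<lambda>n. posterior p prior n (obs n \<omega>) (lhat n (obs n \<omega>))"
    have "\<forall>\<^sub>F n in sequentially. is_MMLE p L prior (Suc n) (obs (Suc n) \<omega>) (lhat (Suc n) (obs (Suc n) \<omega>))"
      using eventually_compose_filterlim[OF elim(4) filterlim_Suc] .
    with elim(2,3) have le: "\<forall>\<^sub>F n in sequentially. measure (?post (Suc n)) (- nbhd d \<theta>0 \<epsilon>)
        \<le> exp (- \<eta> * real (Suc n)) / q"
    proof eventually_elim
      case (elim n)
      let ?n = "Suc n"
      let ?l = "lhat ?n (obs ?n \<omega>)"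
      let ?p0 = "p ?n \<theta>0 (obs ?n \<omega>)"
      have p0: "0 < ?p0" using \<open>\<forall>n. 0 < p (Suc n) \<theta>0 (obs (Suc n) \<omega>)\<close> by blast
      have p_eq: "?p0 * lik_ratio p \<theta>0 ?n \<theta> \<omega> = p ?n \<theta> (obs ?n \<omega>)" for \<theta>
        using p0 by (simp add: lik_ratio_def)
      have l: "?l \<in> ext_hyper L prior"
        and sup: "marg_lik p prior ?n (obs ?n \<omega>) ?l = (SUP l'\<in>L. marg_lik p prior ?n (obs ?n \<omega>) l')"
        using elim(3) by (auto simp: is_MMLE_def)
      \<comment> \<open>This covers boundary values of the estimator too, where the prior is a weak
        limit. Total mass 1 makes the bound on the numerator independent of the selected
        hyperparameter.\<close>
      have Ql: "prob_space (prior ?l)"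
        using ext_hyper_prob_algebra[OF prior l] by (simp add: space_prob_algebra)
      \<comment> \<open>The exponent in (A1) is rewritten by
        \<open>c1 * \<epsilon>\<^sup>2 = 2 * \<eta>\<close>.\<close>
      have p_le: "p ?n \<theta> (obs ?n \<omega>) \<le> ?p0 * exp (- (2 * \<eta> * real ?n))"
        if "\<theta> \<notin> nbhd d \<theta>0 \<epsilon>" for \<theta>
      proof -
        have "(SUP \<theta> \<in> - nbhd d \<theta>0 \<epsilon>. ennreal (lik_ratio p \<theta>0 ?n \<theta> \<omega>))
            < ennreal (exp (- (c1 * real ?n * \<epsilon>\<^sup>2)))"
          using elim(2) \<open>\<omega> \<in> space (P \<theta>0)\<close> by (simp add: A_def not_le)
        moreover have "ennreal (lik_ratio p \<theta>0 ?n \<theta> \<omega>)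
            \<le> (SUP \<theta> \<in> - nbhd d \<theta>0 \<epsilon>. ennreal (lik_ratio p \<theta>0 ?n \<theta> \<omega>))"
          using that by (intro SUP_upper) simp
        ultimately have "ennreal (lik_ratio p \<theta>0 ?n \<theta> \<omega>) \<le> ennreal (exp (- (c1 * real ?n * \<epsilon>\<^sup>2)))"
          by (meson less_imp_le order.strict_trans1)
        then have "lik_ratio p \<theta>0 ?n \<theta> \<omega> \<le> exp (- (2 * \<eta> * real ?n))"
          by (simp add: \<eta>_def mult_ac)
        then show ?thesis
          using p0 by (simp add: p_eq[symmetric, of \<theta>] del: exp_le_cancel_iff)
      qed
      have "(\<integral>\<^sup>+\<theta>\<in>- nbhd d \<theta>0 \<epsilon>. ennreal (p ?n \<theta> (obs ?n \<omega>)) \<partial>prior ?l)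
          \<le> (\<integral>\<^sup>+\<theta>. ennreal (?p0 * exp (- (2 * \<eta> * real ?n))) \<partial>prior ?l)"
        by (intro nn_integral_mono) (auto intro!: ennreal_leI p_le simp del: of_nat_Suc split: split_indicator)
      also have "\<dots> = ennreal (?p0 * exp (- (2 * \<eta> * real ?n)))"
        using Ql by (simp add: prob_space.emeasure_space_1)
      finally have num: "(\<integral>\<^sup>+\<theta>\<in>- nbhd d \<theta>0 \<epsilon>. ennreal (p ?n \<theta> (obs ?n \<omega>)) \<partial>prior ?l)
          \<le> ennreal (?p0 * exp (- (2 * \<eta> * real ?n)))" .
      \<comment> \<open>Multiplying the Fatou bound by \<open>?p0\<close> turns the integrated ratio
        into the marginal likelihood at \<open>l0\<close>.\<close>
      have "ennreal (?p0 * (exp (- (real ?n * \<eta>)) * q))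
          = ennreal ?p0 * (ennreal (exp (- (real ?n * \<eta>))) * ennreal q)"
        using p0 q by (simp add: ennreal_mult)
      also have "\<dots> \<le> ennreal ?p0 * (\<integral>\<^sup>+\<theta>. ennreal (lik_ratio p \<theta>0 ?n \<theta> \<omega>) \<partial>prior l0)"
        using elim(1) by (rule mult_left_mono) simp
      also have "\<dots> = (\<integral>\<^sup>+\<theta>. ennreal ?p0 * ennreal (lik_ratio p \<theta>0 ?n \<theta> \<omega>) \<partial>prior l0)"
      proof (rule nn_integral_cmult[symmetric])
        have "(\<lambda>\<theta>. p ?n \<theta> (obs ?n \<omega>)) \<in> borel_measurable borel"
          using measurable_compose[OF measurable_Pair1'[OF obs_in] density_measurable[of ?n]] by simp
        then have [measurable]: "(\<lambda>\<theta>. p ?n \<theta> (obs ?n \<omega>)) \<in> borel_measurable (prior l0)"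
          using measurable_cong_sets[OF sets_Q0 refl] by blast
        show "(\<lambda>\<theta>. ennreal (lik_ratio p \<theta>0 ?n \<theta> \<omega>)) \<in> borel_measurable (prior l0)"
          unfolding lik_ratio_def by measurable
      qed
      also have "\<dots> = marg_lik p prior ?n (obs ?n \<omega>) l0"
        using p0 by (simp add: marg_lik_def ennreal_mult'[symmetric] p_eq)
      \<comment> \<open>The maximising property enters here: the marginal likelihood at the estimate
        equals the supremum over \<open>L\<close>, and \<open>l0 \<in> L\<close>.\<close>
      also have "\<dots> \<le> marg_lik p prior ?n (obs ?n \<omega>) ?l"
        unfolding sup using l0 by (rule SUP_upper)
      finally have den: "ennreal (?p0 * (exp (- (real ?n * \<eta>)) * q)) \<le> marg_lik p prior ?n (obs ?n \<omega>) ?l" .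
      \<comment> \<open>The factor \<open>?p0\<close> cancels, and of the decay rate
        \<open>2 * \<eta>\<close> in the numerator \<open>\<eta>\<close> survives the
        division.\<close>
      have "emeasure (?post ?n) (- nbhd d \<theta>0 \<epsilon>)
          \<le> ennreal (?p0 * exp (- (2 * \<eta> * real ?n))) / ennreal (?p0 * (exp (- (real ?n * \<eta>)) * q))"
        by (rule order.trans[OF emeasure_posterior_le])
          (intro divide_mono_ennreal num den)
      also have "\<dots> = ennreal (?p0 * exp (- (2 * \<eta> * real ?n)) / (?p0 * (exp (- (real ?n * \<eta>)) * q)))"
        using p0 q by (intro divide_ennreal) auto
      also have "?p0 * exp (- (2 * \<eta> * real ?n)) / (?p0 * (exp (- (real ?n * \<eta>)) * q))
          = exp (- (2 * \<eta> * real ?n)) / exp (- (real ?n * \<eta>)) / q"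
        using p0 q by simp
      also have "\<dots> = exp (- \<eta> * real ?n) / q"
        by (simp add: exp_diff[symmetric] algebra_simps)
      finally show ?case
        unfolding measure_def using q by (intro enn2real_leI) auto
    qed
    have lim: "(\<lambda>n. exp (- \<eta> * real (Suc n)) / q) \<longlonglongrightarrow> 0"
      using \<eta> q by real_asymp
    have "(\<lambda>n. measure (?post (Suc n)) (- nbhd d \<theta>0 \<epsilon>)) \<longlonglongrightarrow> 0"
      by (rule tendsto_sandwich[OF always_eventually le tendsto_const lim]) simp
    then show ?case by (rule LIMSEQ_imp_Suc)
  qed
qed

end
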